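(* Let $\mu$ be a non-decreasing real-valued function on $[0,1]$ (equivalently, a finite positive Borel measure $d\mu$ on $[0,1]$), which may take finitely many or infinitely many different values, and let $$f(\xi)=\int_0^1\frac{d\mu(z)}{1+z\xi},\qquad \xi\in\mathbb{C}\setminus(-\infty,-1].$$ Then for all integers $L,M$ with $L-M+1\ge 0$, $L\neq -1$ and $M\ge 0$, the $[L/M]$ Padé approximant of $f(\xi)$ exists, with constant term of the denominator $b_0=1$.
   Context: With $\mu_n:=\int_0^1 z^n\,d\mu(z)$, one has $f(\xi)=\sum_{n\ge 0}\mu_n(-\xi)^n$ for $|\xi|<1$. For a function $g$ analytic near $\xi=0$ and integers $L,M\ge 0$, the $[L/M]$ Padé approximant of $g$ with $b_0=1$ is said to exist if there are real numbers $a_0,\dots,a_L,b_1,\dots,b_M$ such that the rational function $$[L/M](-\xi)=\frac{a_0+a_1(-\xi)+\cdots+a_L(-\xi)^L}{1+b_1(-\xi)+\cdots+b_M(-\xi)^M}$$ satisfies the accuracy-through-order property $g(\xi)-[L/M](-\xi)=O(\xi^{L+M+1})$ as $\xi\to 0$. (Leading coefficients of numerator and denominator are allowed to vanish.) *)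

theory Defs
  imports
    "HOL-Probability.Distribution_Functions"
    "HOL-Library.Landau_Symbols"
begin

section \<open>The measure of a non-decreasing function on the unit interval\<close>

text \<open>
  The values of \<open>\<mu>\<close> outside \<open>[0,1]\<close> are irrelevant: \<open>\<mu>\<close> is continued by the constants
  \<open>\<mu> 0\<close> to the left and \<open>\<mu> 1\<close> to the right. Since \<open>interval_measure\<close> expects a
  right-continuous function, the continuation is replaced by its right limits. Jumps at the
  endpoints count as usual: the mass at \<open>0\<close> is \<open>\<mu>(0+) - \<mu>(0)\<close> and the mass at \<open>1\<close>
  is \<open>\<mu>(1) - \<mu>(1-)\<close>. Subtracting \<open>\<mu> 0\<close> does not affect the measure.
\<close>

definition unit_cdf :: "(real \<Rightarrow> real) \<Rightarrow> real \<Rightarrow> real" where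
  "unit_cdf \<mu> x = Lim (at_right x) (\<lambda>t. \<mu> (max 0 (min 1 t)) - \<mu> 0)"

definition unit_stieltjes_measure :: "(real \<Rightarrow> real) \<Rightarrow> real measure" where
  "unit_stieltjes_measure \<mu> = interval_measure (unit_cdf \<mu>)"

lemma unit_cdf_eqI:
  assumes "((\<lambda>t. \<mu> (max 0 (min 1 t)) - \<mu> 0) \<longlongrightarrow> l) (at_right x)"
  shows "unit_cdf \<mu> x = l"
  unfolding unit_cdf_def using assms by (intro tendsto_Lim) auto

lemma tendsto_unit_cdf:
  assumes "mono_on {0..1} \<mu>"
  shows "((\<lambda>t. \<mu> (max 0 (min 1 t)) - \<mu> 0) \<longlongrightarrow> unit_cdf \<mu> x) (at_right x)"
proof -
  let ?G = "\<lambda>t. \<mu> (max 0 (min 1 t)) - \<mu> 0"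
  have mono: "?G a \<le> ?G b" if "a \<le> b" for a b
    using that by (intro diff_right_mono mono_onD[OF assms]) auto
  have "(?G \<longlongrightarrow> Inf (?G ` ({x<..} \<inter> UNIV))) (at x within ({x<..} \<inter> UNIV))"
    by (rule Lim_right_bound[where K = "?G x"]) (rule mono; simp)+
  then have "(?G \<longlongrightarrow> Inf (?G ` {x<..})) (at_right x)"
    by simp
  with unit_cdf_eqI[OF this] show ?thesis
    by simp
qed

lemma unit_cdf_bounds:
  assumes \<mu>: "mono_on {0..1} \<mu>" and "x < y"
  shows "\<mu> (max 0 (min 1 x)) - \<mu> 0 \<le> unit_cdf \<mu> x"
    and "unit_cdf \<mu> x \<le> \<mu> (max 0 (min 1 y)) - \<mu> 0"
proof -
  let ?G = "\<lambda>t. \<mu> (max 0 (min 1 t)) - \<mu> 0"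
  have mono: "?G a \<le> ?G b" if "a \<le> b" for a b
    using that by (intro diff_right_mono mono_onD[OF \<mu>]) auto
  have ev: "\<forall>\<^sub>F t in at_right x. t \<in> {x<..<y}"
    using \<open>x < y\<close> by (rule eventually_at_right_real)
  show "?G x \<le> unit_cdf \<mu> x"
  proof (rule tendsto_lowerbound[OF tendsto_unit_cdf[OF \<mu>]])
    show "\<forall>\<^sub>F t in at_right x. ?G x \<le> ?G t"
      using ev by eventually_elim (rule mono, simp)
  qed simp
  show "unit_cdf \<mu> x \<le> ?G y"
  proof (rule tendsto_upperbound[OF tendsto_unit_cdf[OF \<mu>]])
    show "\<forall>\<^sub>F t in at_right x. ?G t \<le> ?G y"
      using ev by eventually_elim (rule mono, simp)
  qed simp
qed

lemma unit_cdf_mono: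
  assumes "mono_on {0..1} \<mu>" "x \<le> y"
  shows "unit_cdf \<mu> x \<le> unit_cdf \<mu> y"
proof (cases "x = y")
  case False
  with assms have "x < y" by simp
  from unit_cdf_bounds(2)[OF assms(1) this] unit_cdf_bounds(1)[OF assms(1), of y "y + 1"]
  show ?thesis by linarith
qed simp

lemma unit_cdf_right_cont:
  assumes \<mu>: "mono_on {0..1} \<mu>"
  shows "continuous (at_right a) (unit_cdf \<mu>)"
proof (subst continuous_at_right_real_increasing, rule unit_cdf_mono[OF \<mu>], assumption,
    intro allI impI)
  fix e :: real assume "e > 0"
  let ?G = "\<lambda>t. \<mu> (max 0 (min 1 t)) - \<mu> 0"
  have "\<forall>\<^sub>F t in at_right a. dist (?G t) (unit_cdf \<mu> a) < e"
    by (rule tendstoD[OF tendsto_unit_cdf[OF \<mu>] \<open>e > 0\<close>])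
  then obtain b where b: "a < b" "\<And>t. a < t \<Longrightarrow> t < b \<Longrightarrow> dist (?G t) (unit_cdf \<mu> a) < e"
    by (auto simp: eventually_at_right_field)
  define s where "s = (a + b) / 2"
  define t where "t = (a + s) / 2"
  have st: "a < t" "t < s" "s < b" using b(1) by (auto simp: s_def t_def)
  have "unit_cdf \<mu> t \<le> ?G s" by (rule unit_cdf_bounds(2)[OF \<mu> st(2)])
  also have "\<dots> < unit_cdf \<mu> a + e" using b(2)[of s] st by (auto simp: dist_real_def)
  finally show "\<exists>d>0. unit_cdf \<mu> (a + d) - unit_cdf \<mu> a < e"
    using st by (intro exI[of _ "t - a"]) auto
qed

lemma unit_cdf_outside:
  shows unit_cdf_less_0: "x < 0 \<Longrightarrow> unit_cdf \<mu> x = 0"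
    and unit_cdf_ge_1: "x \<ge> 1 \<Longrightarrow> unit_cdf \<mu> x = \<mu> 1 - \<mu> 0"
proof -
  assume "x < 0"
  then have "\<forall>\<^sub>F t in at_right x. t \<in> {x<..<0}" by (rule eventually_at_right_real)
  then have "\<forall>\<^sub>F t in at_right x. \<mu> (max 0 (min 1 t)) - \<mu> 0 = 0"
    by eventually_elim (auto simp: max_def min_def)
  then show "unit_cdf \<mu> x = 0"
    by (intro unit_cdf_eqI tendsto_eventually)
next
  assume "x \<ge> 1"
  have "\<forall>\<^sub>F t in at_right x. t \<in> {x<..<x+1}" by (rule eventually_at_right_real) simp
  then have "\<forall>\<^sub>F t in at_right x. \<mu> (max 0 (min 1 t)) - \<mu> 0 = \<mu> 1 - \<mu> 0"
    by eventually_elim (use \<open>x \<ge> 1\<close> in \<open>auto simp: max_def min_def\<close>)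
  then show "unit_cdf \<mu> x = \<mu> 1 - \<mu> 0"
    by (intro unit_cdf_eqI tendsto_eventually)
qed

lemma unit_cdf_at_bot: "(unit_cdf \<mu> \<longlongrightarrow> 0) at_bot"
  by (rule tendsto_eventually, rule eventually_mono[OF eventually_gt_at_bot[of 0]])
     (simp add: unit_cdf_less_0)

lemma unit_cdf_at_top: "(unit_cdf \<mu> \<longlongrightarrow> \<mu> 1 - \<mu> 0) at_top"
  by (rule tendsto_eventually, rule eventually_mono[OF eventually_ge_at_top[of 1]])
     (simp add: unit_cdf_ge_1)

lemma finite_borel_measure_unit_stieltjes:
  assumes "mono_on {0..1} \<mu>"
  shows "finite_borel_measure (unit_stieltjes_measure \<mu>)"
  unfolding unit_stieltjes_measure_def
  by (rule finite_borel_measure_interval_measure[OF unit_cdf_mono[OF assms]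
        unit_cdf_right_cont[OF assms] unit_cdf_at_bot unit_cdf_at_top])
     (auto intro!: mono_onD[OF assms])

lemma cdf_unit_stieltjes:
  assumes "mono_on {0..1} \<mu>"
  shows "cdf (unit_stieltjes_measure \<mu>) = unit_cdf \<mu>"
  unfolding unit_stieltjes_measure_def
  by (rule cdf_interval_measure[OF unit_cdf_mono[OF assms] unit_cdf_right_cont[OF assms]
        unit_cdf_at_bot])

lemma emeasure_unit_stieltjes_outside:
  assumes \<mu>: "mono_on {0..1} \<mu>"
  shows "emeasure (unit_stieltjes_measure \<mu>) (- {0..1}) = 0"
proof -
  interpret finite_borel_measure "unit_stieltjes_measure \<mu>"
    by (rule finite_borel_measure_unit_stieltjes[OF \<mu>])
  let ?M = "unit_stieltjes_measure \<mu>"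
  have "emeasure ?M {..<0} = 0"
  proof -
    have "((\<lambda>x. cdf ?M x) \<longlongrightarrow> measure ?M {..<0}) (at_left 0)" by (rule cdf_at_left)
    moreover have "((\<lambda>x. cdf ?M x) \<longlongrightarrow> 0) (at_left 0)"
      by (rule tendsto_eventually, rule eventually_mono[OF eventually_at_left_real[of "-1"]])
         (auto simp: cdf_unit_stieltjes[OF \<mu>] unit_cdf_less_0)
    ultimately have "measure ?M {..<0} = 0"
      by (rule tendsto_unique[OF trivial_limit_at_left_real])
    then show ?thesis by (simp add: emeasure_eq_measure)
  qed
  moreover have "emeasure ?M {1<..} = 0"
  proof -
    have "(cdf ?M \<longlongrightarrow> \<mu> 1 - \<mu> 0) at_top"
      by (simp only: cdf_unit_stieltjes[OF \<mu>] unit_cdf_at_top)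
    then have "measure ?M (space ?M) = \<mu> 1 - \<mu> 0"
      by (rule tendsto_unique[OF trivial_limit_at_top_linorder cdf_lim_at_top])
    moreover have "measure ?M {..1} = \<mu> 1 - \<mu> 0"
      using cdf_unit_stieltjes[OF \<mu>] by (simp add: cdf_def fun_eq_iff unit_cdf_ge_1)
    moreover have "measure ?M (space ?M - {..1}) = measure ?M (space ?M) - measure ?M {..1}"
      by (rule finite_measure_compl) auto
    moreover have "space ?M - {..1} = {1<..}" by (auto simp: borel_UNIV)
    ultimately show ?thesis by (simp add: emeasure_eq_measure)
  qed
  moreover have "- {0..1} = {..<0} \<union> {1::real<..}" by auto
  moreover have "emeasure ?M ({..<0} \<union> {1<..}) \<le> emeasure ?M {..<0} + emeasure ?M {1<..}"
    by (rule emeasure_subadditive) auto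
  ultimately show ?thesis by simp
qed

text \<open>
  Conversely, every finite Borel measure concentrated on \<open>[0,1]\<close> arises in this way. The value
  of its distribution function at \<open>0\<close> is lowered to \<open>0\<close> in order to record a mass at \<open>0\<close>.
\<close>

lemma finite_borel_measure_eq_unit_stieltjes:
  assumes "finite_borel_measure M" and null: "emeasure M (- {0..1}) = 0"
  defines "\<mu> \<equiv> \<lambda>x. if x \<le> 0 then 0 else cdf M x"
  shows "mono_on {0..1} \<mu>" and "unit_stieltjes_measure \<mu> = M"
proof -
  interpret finite_borel_measure M by fact
  show mono: "mono_on {0..1} \<mu>"
  proof (rule mono_onI)
    fix r s :: real assume "r \<le> s"
    then show "\<mu> r \<le> \<mu> s"
      using cdf_nonneg[of s] cdf_nondecreasing[of r s] by (simp add: \<mu>_def)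
  qed
  have left: "cdf M x = 0" if "x < 0" for x
  proof -
    have "emeasure M {..x} \<le> emeasure M (- {0..1})"
      using that by (intro emeasure_mono) auto
    then show ?thesis using null by (simp add: cdf_def measure_def)
  qed
  have right: "cdf M x = cdf M 1" if "x \<ge> 1" for x
  proof (cases "x = 1")
    case False
    have "emeasure M {1<..x} \<le> emeasure M (- {0..1})"
      by (intro emeasure_mono) auto
    then show ?thesis using null cdf_diff_eq[of 1 x] that False by (simp add: measure_def)
  qed simp
  have "unit_cdf \<mu> x = cdf M x" for x
  proof (cases "x < 0")
    case True
    then show ?thesis by (simp add: unit_cdf_less_0 left)
  next
    case False
    have "\<forall>\<^sub>F t in at_right x. t \<in> {x<..<x+1}" by (rule eventually_at_right_real) simp
    then have ev: "\<forall>\<^sub>F t in at_right x. cdf M t = \<mu> (max 0 (min 1 t)) - \<mu> 0"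
    proof eventually_elim
      case (elim t)
      then show ?case
        using False right[of t] by (cases "t \<le> 1") (simp_all add: \<mu>_def)
    qed
    have "(cdf M \<longlongrightarrow> cdf M x) (at_right x)"
      using cdf_is_right_cont[of x] by (simp add: continuous_within)
    from unit_cdf_eqI[OF Lim_transform_eventually[OF this ev]] show ?thesis .
  qed
  then have "cdf (unit_stieltjes_measure \<mu>) = cdf M"
    by (simp add: cdf_unit_stieltjes[OF mono] fun_eq_iff)
  then show "unit_stieltjes_measure \<mu> = M"
    by (rule cdf_unique'[OF finite_borel_measure_unit_stieltjes[OF mono] assms(1)])
qed


section \<open>Pade approximants\<close>

text \<open>
  The approximant is a rational function of \<open>x = -\<xi>\<close>, as appropriate for expansions in powers
  of \<open>-\<xi>\<close>. The coefficients are real; only \<open>a 0, \<dots>, a L\<close> and \<open>b 0, \<dots>, b M\<close> matter, and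
  \<open>a L\<close> and \<open>b M\<close> may vanish. The notion is meant for \<open>g\<close> analytic near \<open>0\<close>.
\<close>

definition pade_fraction ::
    "nat \<Rightarrow> nat \<Rightarrow> (nat \<Rightarrow> real) \<Rightarrow> (nat \<Rightarrow> real) \<Rightarrow> complex \<Rightarrow> complex" where
  "pade_fraction L M a b x =
     (\<Sum>i=0..L. complex_of_real (a i) * x ^ i) / (\<Sum>j=0..M. complex_of_real (b j) * x ^ j)"

definition is_pade_approximant ::
    "(complex \<Rightarrow> complex) \<Rightarrow> nat \<Rightarrow> nat \<Rightarrow> (nat \<Rightarrow> real) \<Rightarrow> (nat \<Rightarrow> real) \<Rightarrow> bool" where
  "is_pade_approximant g L M a b \<longleftrightarrow>
     (\<lambda>\<xi>. g \<xi> - pade_fraction L M a b (- \<xi>)) \<in> O[at 0](\<lambda>\<xi>. \<xi> ^ (L + M + 1))"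

end

theory Submission
  imports Defs
begin

text \<open>
  For a denominator with coefficients \<open>b\<^sub>0 = 1, b\<^sub>1, \<dots>, b\<^sub>M\<close>, accuracy through order is the linear
  system \<open>\<Sum>\<^sub>j b\<^sub>j \<mu>\<^bsub>k-j\<^esub> = 0\<close> for \<open>L < k \<le> L + M\<close>; the numerator is then the truncated product
  series. In terms of the reversed denominator \<open>q(z) = \<Sum>\<^sub>j b\<^sub>j z\<^bsup>M-j\<^esup>\<close> the system says that the
  monic polynomial \<open>q\<close> of degree \<open>M\<close> is orthogonal to all polynomials of lower degree with
  respect to the positive measure \<open>z\<^bsup>L-M+1\<^esup> d\<mu>(z)\<close>. Such a \<open>q\<close> exists by Gram-Schmidt even if
  the bilinear form is degenerate (finitely many atoms), since by Cauchy-Schwarz a null vector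
  of a positive semidefinite form is orthogonal to everything.
\<close>

section \<open>Monic orthogonal polynomials for a positive semidefinite form\<close>

lemma affine_nonneg_slope_eq_0:
  fixes a b :: real
  assumes "\<And>t. 0 \<le> a + 2 * t * b"
  shows "b = 0"
proof (rule ccontr)
  assume "b \<noteq> 0"
  \<comment> \<open>This \<open>t\<close> makes the affine expression equal to
    \<open>-1\<close>.\<close>
  then show False
    using assms[of "- (a + 1) / (2 * b)"] by (simp add: field_simps)
qed

text \<open>\<open>I\<close> models integration and \<open>w\<close> a weight. Only semidefiniteness
  is demanded, so measures with finitely many atoms are covered.\<close>

locale semidefinite_functional =
  fixes I :: "real poly \<Rightarrow> real" and w :: "real poly"
  assumes add: "I (p + q) = I p + I q"
    and smult: "I (smult c p) = c * I p"
    and nonneg: "0 \<le> I (w * p * p)"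
begin

lemma diff: "I (p - q) = I p - I q"
  using add[of p "smult (-1) q"] smult[of "-1" q] by simp

text \<open>Degenerate case of Cauchy-Schwarz: the form at \<open>r + smult t q\<close> is quadratic
  in \<open>t\<close> with vanishing leading term, hence affine and nonnegative for all real
  \<open>t\<close>.\<close>

lemma null: "I (w * q * r) = 0" if "I (w * q * q) = 0"
proof (rule affine_nonneg_slope_eq_0)
  fix t
  have "w * (r + smult t q) * (r + smult t q)
      = w * r * r + smult (2 * t) (w * q * r) + smult (t * t) (w * q * q)"
    by (simp add: poly_eq_poly_eq_iff[symmetric] fun_eq_iff algebra_simps)
  then show "0 \<le> I (w * r * r) + 2 * t * I (w * q * r)"
    using nonneg[of "r + smult t q"] that by (simp add: add smult)
qed

text \<open>One Gram-Schmidt step per induction step. \<open>v\<close> stays arbitrary because the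
  hypothesis is applied both to \<open>v\<close> and to \<open>monom 1 n\<close>, the latter
  yielding the new direction \<open>q\<close>. Bounding coefficients instead of the degree makes
  \<open>n = 0\<close> force \<open>p = 0\<close>.\<close>

lemma exists_projection:
  "\<exists>p. (\<forall>i\<ge>n. coeff p i = 0) \<and> (\<forall>m<n. I (w * (v - p) * monom 1 m) = 0)"
proof (induction n arbitrary: v)
  case 0
  show ?case by (intro exI[of _ 0]) simp
next
  case (Suc n)
  obtain p where p: "\<And>i. i \<ge> n \<Longrightarrow> coeff p i = 0"
      "\<And>m. m < n \<Longrightarrow> I (w * (v - p) * monom 1 m) = 0"
    using Suc[of v] by blast
  obtain s where s: "\<And>i. i \<ge> n \<Longrightarrow> coeff s i = 0"
      "\<And>m. m < n \<Longrightarrow> I (w * (monom 1 n - s) * monom 1 m) = 0"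
    using Suc[of "monom 1 n"] by blast
  define q where "q = monom 1 n - s"
  \<comment> \<open>For a null vector \<open>q\<close> division by zero gives \<open>c = 0\<close>;
    any value would do, by \<open>null\<close>.\<close>
  define c where "c = I (w * (v - p) * q) / I (w * q * q)"
  define u where "u = v - (p + smult c q)"
  have u_eq: "w * u * r = w * (v - p) * r - smult c (w * q * r)" for r
    by (simp add: u_def algebra_simps)
  have low: "I (w * u * monom 1 m) = 0" if "m < n" for m
    using p(2)[OF that] s(2)[OF that] by (simp add: u_eq diff smult q_def)
  have low': "I (w * u * s) = 0"
  proof -
    have low_sum: "I (w * u * (\<Sum>i<k. monom (coeff s i) i)) = 0" if "k \<le> n" for k
      using that
    proof (induction k)
      case 0
      show ?case using smult[of 0 0] by simp
    next
      case (Suc k)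
      have "w * u * monom (coeff s k) k = smult (coeff s k) (w * u * monom 1 k)"
        by (metis mult.right_neutral mult_smult_right smult_monom)
      then show ?case
        using Suc low[of k] by (simp add: distrib_left add smult)
    qed
    have "s = (\<Sum>i<n. monom (coeff s i) i)"
      by (rule poly_eqI) (use s(1) in \<open>auto simp: coeff_sum not_less\<close>)
    then show ?thesis using low_sum[of n] by simp
  qed
  have "I (w * u * q) = 0"
  proof (cases "I (w * q * q) = 0")
    case True
    then show ?thesis using null[OF True, of u] by (simp add: mult_ac)
  next
    case False
    then show ?thesis by (simp add: u_eq diff smult c_def)
  qed
  \<comment> \<open>Here \<open>monom 1 n\<close> is \<open>q + s\<close>, and \<open>u\<close> is
    orthogonal to both summands.\<close>
  then have top: "I (w * u * monom 1 n) = 0"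
    using low' add[of "w * u * q" "w * u * s"] by (simp add: q_def algebra_simps)
  show ?case
  proof (intro exI[of _ "p + smult c q"] conjI allI impI)
    fix i assume "Suc n \<le> i"
    then show "coeff (p + smult c q) i = 0"
      by (simp add: p(1) s(1) q_def)
  next
    fix m assume "m < Suc n"
    then show "I (w * (v - (p + smult c q)) * monom 1 m) = 0"
      using low[of m] top by (auto simp: less_Suc_eq u_def)
  qed
qed

text \<open>Subtracting from \<open>monom 1 n\<close> its projection onto lower degrees leaves the
  leading term intact.\<close>

lemma exists_monic_orthogonal:
  obtains q where "degree q = n" "lead_coeff q = 1" "\<And>m. m < n \<Longrightarrow> I (w * q * monom 1 m) = 0"
proof -
  obtain p where p: "\<And>i. i \<ge> n \<Longrightarrow> coeff p i = 0"
      "\<And>m. m < n \<Longrightarrow> I (w * (monom 1 n - p) * monom 1 m) = 0"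
    using exists_projection[of n "monom 1 n"] by blast
  have "degree (monom 1 n - p) = n"
    by (rule antisym; (rule degree_le | rule le_degree)) (auto simp: p(1))
  with p show thesis
    by (intro that[of "monom 1 n - p"]) auto
qed

end

section \<open>From the linear system to accuracy through order\<close>

lemma is_pade_approximant_if_linear_system:
  fixes m b :: "nat \<Rightarrow> real"
  assumes g: "(\<lambda>\<xi>. g \<xi> - (\<Sum>n<L + M + 1. of_real (m n) * (- \<xi>) ^ n)) \<in> O[at 0](\<lambda>\<xi>. \<xi> ^ (L + M + 1))"
    and b0: "b 0 = 1"
    and system: "\<And>k. L < k \<Longrightarrow> k \<le> L + M \<Longrightarrow> (\<Sum>j\<le>min k M. b j * m (k - j)) = 0"
  shows "is_pade_approximant g L M (\<lambda>k. \<Sum>j\<le>min k M. b j * m (k - j)) b"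
proof -
  define N where "N = L + M + 1"
  \<comment> \<open>Coefficients of denominator times series. The bound \<open>min k M\<close> stops
    at the last denominator coefficient and keeps \<open>k - j\<close> from being truncated.\<close>
  define a where "a k = (\<Sum>j\<le>min k M. b j * m (k - j))" for k
  define pa where "pa = (\<Sum>i\<le>L. monom (complex_of_real (a i)) i)"
  define pb where "pb = (\<Sum>j\<le>M. monom (complex_of_real (b j)) j)"
  define ps where "ps = (\<Sum>n<N. monom (complex_of_real (m n)) n)"
  have coeff_pa: "coeff pa k = (if k \<le> L then of_real (a k) else 0)" for k
    by (simp add: pa_def coeff_sum)
  have coeff_pb: "coeff pb k = (if k \<le> M then of_real (b k) else 0)" for k
    by (simp add: pb_def coeff_sum)
  have coeff_ps: "coeff ps k = (if k < N then of_real (m k) else 0)" for k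
    by (simp add: ps_def coeff_sum)
  \<comment> \<open>Up to \<open>L\<close> the numerator cancels the product; from
    \<open>L + 1\<close> to \<open>L + M\<close> the product itself vanishes by
    \<open>system\<close>.\<close>
  have "coeff (pb * ps - pa) k = 0" if "k < N" for k
  proof -
    have "coeff (pb * ps) k = (\<Sum>j\<le>k. if j \<le> M then of_real (b j * m (k - j)) else 0)"
      unfolding coeff_mult using that
      by (intro sum.cong) (auto simp: coeff_pb coeff_ps)
    also have "\<dots> = (\<Sum>j\<le>min k M. of_real (b j * m (k - j)))"
      by (rule sum.mono_neutral_cong_right) auto
    also have "\<dots> = of_real (a k)"
      by (simp add: a_def)
    finally have "coeff (pb * ps) k = of_real (a k)" .
    moreover have "a k = 0" if "L < k"
      using system[of k] that \<open>k < N\<close> by (simp add: a_def N_def)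
    ultimately show ?thesis
      by (simp add: coeff_pa)
  qed
  then have "monom 1 N dvd pb * ps - pa"
    by (simp add: monom_1_dvd_iff')
  then obtain r where r: "pb * ps - pa = monom 1 N * r"
    by (elim dvdE)
  let ?B = "\<lambda>\<xi>. poly pb (- \<xi>)"
  have B_lim: "(?B \<longlongrightarrow> ?B 0) (at 0)"
    by (intro tendsto_intros)
  have B0: "?B 0 = 1"
    by (simp add: poly_0_coeff_0 coeff_pb b0)
  have const_O: "(\<lambda>\<xi>. poly p (- \<xi>)) \<in> O[at 0](\<lambda>_. 1)" for p :: "complex poly"
  proof (rule bigoI_tendsto)
    show "((\<lambda>\<xi>. poly p (- \<xi>) / 1) \<longlongrightarrow> poly p (- 0)) (at 0)"
      unfolding div_by_1 by (intro tendsto_intros)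
  qed auto
  \<comment> \<open>This is the error times the denominator: B (g - A/B) = B (g - S) + (B S - A),
    with S the truncated series and B S - A divisible by the \<open>N\<close>-th power.\<close>
  have "(\<lambda>\<xi>. ?B \<xi> * (g \<xi> - poly ps (- \<xi>)) + (- \<xi>) ^ N * poly r (- \<xi>)) \<in> O[at 0](\<lambda>\<xi>. \<xi> ^ N)"
  proof (rule sum_in_bigo)
    have "(\<lambda>\<xi>. ?B \<xi> * (g \<xi> - poly ps (- \<xi>))) \<in> O[at 0](\<lambda>\<xi>. 1 * \<xi> ^ N)"
      using g by (intro landau_o.big.mult const_O) (simp add: ps_def poly_sum poly_monom N_def)
    then show "(\<lambda>\<xi>. ?B \<xi> * (g \<xi> - poly ps (- \<xi>))) \<in> O[at 0](\<lambda>\<xi>. \<xi> ^ N)"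
      by simp
    have "(\<lambda>\<xi>. (- \<xi>) ^ N * poly r (- \<xi>)) \<in> O[at 0](\<lambda>\<xi>. \<xi> ^ N * 1)"
      by (intro landau_o.big.mult const_O bigoI[of _ 1]) (simp add: norm_power)
    then show "(\<lambda>\<xi>. (- \<xi>) ^ N * poly r (- \<xi>)) \<in> O[at 0](\<lambda>\<xi>. \<xi> ^ N)"
      by simp
  qed
  \<comment> \<open>Since \<open>b 0 = 1\<close>, the denominator tends to 1, so dividing by it
    keeps the order.\<close>
  moreover have "(\<lambda>\<xi>. inverse (?B \<xi>)) \<in> O[at 0](\<lambda>_. 1)"
  proof (rule bigoI_tendsto)
    show "((\<lambda>\<xi>. inverse (?B \<xi>) / 1) \<longlongrightarrow> inverse (?B 0)) (at 0)"
      unfolding div_by_1 using B0 by (intro tendsto_inverse B_lim) auto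
  qed auto
  ultimately have "(\<lambda>\<xi>. inverse (?B \<xi>) * (?B \<xi> * (g \<xi> - poly ps (- \<xi>)) + (- \<xi>) ^ N * poly r (- \<xi>)))
      \<in> O[at 0](\<lambda>\<xi>. 1 * \<xi> ^ N)"
    by (rule landau_o.big.mult[rotated])
  moreover have "\<forall>\<^sub>F \<xi> in at 0. inverse (?B \<xi>) * (?B \<xi> * (g \<xi> - poly ps (- \<xi>)) + (- \<xi>) ^ N * poly r (- \<xi>))
      = g \<xi> - pade_fraction L M a b (- \<xi>)"
  proof -
    have "\<forall>\<^sub>F \<xi> in at 0. ?B \<xi> \<noteq> 0"
      using B_lim B0 by (intro tendsto_imp_eventually_ne[OF B_lim]) simp
    then show ?thesis
    proof eventually_elim
      case (elim \<xi>)
      have "poly (pb * ps - pa) (- \<xi>) = (- \<xi>) ^ N * poly r (- \<xi>)"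
        by (simp add: r poly_monom)
      moreover have "pade_fraction L M a b (- \<xi>) = poly pa (- \<xi>) / ?B \<xi>"
        by (simp add: pade_fraction_def pa_def pb_def poly_sum poly_monom atMost_atLeast0)
      ultimately show ?case
        using elim by (simp add: field_simps)
    qed
  qed
  ultimately have "(\<lambda>\<xi>. g \<xi> - pade_fraction L M a b (- \<xi>)) \<in> O[at 0](\<lambda>\<xi>. \<xi> ^ N)"
    by (simp add: landau_o.big.in_cong)
  then show ?thesis
    by (simp add: is_pade_approximant_def a_def[abs_def] N_def)
qed

section \<open>Moments and the Stieltjes transform on the unit interval\<close>

context finite_borel_measure
begin

lemma set_integrable_unit_continuous:
  fixes h :: "real \<Rightarrow> 'b :: {banach, second_countable_topology}"
  assumes "continuous_on {0..1} h"
  shows "set_integrable M {0..1} h"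
proof -
  have "compact (h ` {0..1})"
    by (intro compact_continuous_image assms) simp
  then obtain B where B: "\<And>x. x \<in> {0..1} \<Longrightarrow> norm (h x) \<le> B"
    by (meson bounded_iff compact_imp_bounded imageI)
  have "(\<lambda>x. indicator {0..1} x *\<^sub>R h x) \<in> borel_measurable borel"
    by (rule borel_measurable_continuous_on_indicator[OF _ assms]) simp
  then have "(\<lambda>x. indicator {0..1} x *\<^sub>R h x) \<in> borel_measurable M"
    by (simp add: measurable_cong_sets[OF M_is_borel refl])
  then show ?thesis
    unfolding set_integrable_def
    by (intro integrable_const_bound[of _ "max B 0"])
       (auto simp: indicator_def le_max_iff_disj B)
qed

definition unit_moment :: "nat \<Rightarrow> real" where
  "unit_moment n = (LINT z:{0..1}|M. z ^ n)"

text \<open>A finite geometric sum leaves the remainder y^N / (1 - y) with y = -z\<xi>. For |\<xi>|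
  < 1/2 and z in [0,1] the denominator has modulus at least 1/2, whence the factor 2; integration
  contributes the mass of [0,1].\<close>

lemma stieltjes_transform_bigo:
  "(\<lambda>\<xi>. (LINT z:{0..1}|M. 1 / (1 + complex_of_real z * \<xi>))
      - (\<Sum>n<N. of_real (unit_moment n) * (- \<xi>) ^ n)) \<in> O[at 0](\<lambda>\<xi>. \<xi> ^ N)"
proof (rule bigoI[of _ "2 * measure M {0..1}"])
  have "\<forall>\<^sub>F \<xi> in at 0. norm (\<xi>::complex) < 1/2"
    by (intro order_tendstoD(2)[where y = 0] tendsto_norm_zero tendsto_ident_at) simp
  then show "\<forall>\<^sub>F \<xi> in at 0. norm ((LINT z:{0..1}|M. 1 / (1 + complex_of_real z * \<xi>))
      - (\<Sum>n<N. of_real (unit_moment n) * (- \<xi>) ^ n)) \<le> 2 * measure M {0..1} * norm (\<xi> ^ N)"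
  proof eventually_elim
    case (elim \<xi>)
    have lower: "norm (1 + complex_of_real z * \<xi>) \<ge> 1/2" if "z \<in> {0..1}" for z
    proof -
      have "norm (complex_of_real z * \<xi>) \<le> 1 * (1/2)"
        using that elim unfolding norm_mult by (intro mult_mono) auto
      then show ?thesis
        using norm_diff_ineq[of 1 "complex_of_real z * \<xi>"] by simp
    qed
    have ne: "1 + complex_of_real z * \<xi> \<noteq> 0" if "z \<in> {0..1}" for z
      using lower[OF that] by auto
    let ?h = "\<lambda>z. 1 / (1 + complex_of_real z * \<xi>)"
    let ?s = "\<lambda>z. \<Sum>n<N. complex_of_real (z ^ n) * (- \<xi>) ^ n"
    have int_h: "set_integrable M {0..1} ?h"
      using ne by (intro set_integrable_unit_continuous continuous_intros) auto
    have int_n: "set_integrable M {0..1} (\<lambda>z. complex_of_real (z ^ n) * (- \<xi>) ^ n)" for n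
      by (intro set_integrable_unit_continuous continuous_intros)
    have int_s: "set_integrable M {0..1} ?s"
      by (intro set_integrable_unit_continuous continuous_intros)
    have "(LINT z:{0..1}|M. ?s z) = (\<Sum>n<N. LINT z:{0..1}|M. complex_of_real (z ^ n) * (- \<xi>) ^ n)"
      using int_n unfolding set_lebesgue_integral_def set_integrable_def scaleR_sum_right
      by (subst Bochner_Integration.integral_sum) auto
    also have "\<dots> = (\<Sum>n<N. of_real (unit_moment n) * (- \<xi>) ^ n)"
      by (simp only: set_integral_mult_left set_integral_complex_of_real unit_moment_def)
    finally have "(LINT z:{0..1}|M. ?h z) - (\<Sum>n<N. of_real (unit_moment n) * (- \<xi>) ^ n)
        = (LINT z:{0..1}|M. ?h z - ?s z)"
      using int_h int_s by (simp add: set_integral_diff)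
    also have "norm \<dots> \<le> (LINT z|M. indicator {0..1} z * (2 * norm (\<xi> ^ N)))"
      unfolding set_lebesgue_integral_def
    proof (rule Bochner_Integration.integral_norm_bound_integral)
      show "integrable M (\<lambda>z. indicator {0..1} z *\<^sub>R (?h z - ?s z))"
        using set_integral_diff(1)[OF int_h int_s] by (simp add: set_integrable_def)
      show "integrable M (\<lambda>z. indicator {0..1} z * (2 * norm (\<xi> ^ N)))"
        by (intro integrable_mult_left integrable_real_indicator) (auto simp: emeasure_finite less_top[symmetric])
      fix z
      show "norm (indicator {0..1} z *\<^sub>R (?h z - ?s z)) \<le> indicator {0..1} z * (2 * norm (\<xi> ^ N))"
      proof (cases "z \<in> {0..1}")
        case True
        let ?y = "- (complex_of_real z * \<xi>)"
        have "?s z = (\<Sum>n<N. ?y ^ n)"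
          by (intro sum.cong) (simp_all flip: power_mult_distrib)
        also have "\<dots> = (1 - ?y ^ N) / (1 + complex_of_real z * \<xi>)"
          using ne[OF True] one_diff_power_eq[of ?y N] by (simp add: field_simps)
        finally have "?h z - ?s z = ?y ^ N / (1 + complex_of_real z * \<xi>)"
          by (simp add: diff_divide_distrib)
        also have "norm \<dots> \<le> norm (\<xi> ^ N) / (1/2)"
          unfolding norm_divide
        proof (rule frac_le)
          have "norm (?y ^ N) = z ^ N * norm (\<xi> ^ N)"
            using True by (simp add: norm_power norm_mult power_mult_distrib)
          also have "\<dots> \<le> 1 * norm (\<xi> ^ N)"
            using True by (intro mult_right_mono power_le_one) auto
          finally show "norm (?y ^ N) \<le> norm (\<xi> ^ N)" by simp
        qed (use lower[OF True] in auto)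
        finally show ?thesis using True by simp
      qed simp
    qed
    also have "\<dots> = 2 * measure M {0..1} * norm (\<xi> ^ N)"
      by (simp add: borel_UNIV)
    finally show ?case .
  qed
qed

definition unit_integral :: "real poly \<Rightarrow> real" where
  "unit_integral p = (LINT z:{0..1}|M. poly p z)"

lemma set_integrable_poly: "set_integrable M {0..1} (poly p)" for p :: "real poly"
  by (intro set_integrable_unit_continuous continuous_intros)

text \<open>On [0,1] the weight z^s is nonnegative, so the form integrates a weight times a
  square.\<close>

lemma semidefinite_unit_integral: "semidefinite_functional unit_integral (monom 1 s)"
proof
  fix p q :: "real poly" and c :: real
  show "unit_integral (p + q) = unit_integral p + unit_integral q"
    by (simp add: unit_integral_def set_integral_add set_integrable_poly)
  show "unit_integral (smult c p) = c * unit_integral p"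
    by (simp add: unit_integral_def)
  show "0 \<le> unit_integral (monom 1 s * p * p)"
    unfolding unit_integral_def set_lebesgue_integral_def
    by (intro Bochner_Integration.integral_nonneg) (auto simp: indicator_def poly_monom mult.assoc)
qed

lemma unit_integral_monom_mult:
  "unit_integral (monom 1 k * p) = (\<Sum>i\<le>degree p. coeff p i * unit_moment (k + i))"
proof -
  have int: "set_integrable M {0..1} (\<lambda>z. coeff p i * z ^ (k + i))" for i
    by (intro set_integrable_unit_continuous continuous_intros)
  have "unit_integral (monom 1 k * p) = (LINT z:{0..1}|M. \<Sum>i\<le>degree p. coeff p i * z ^ (k + i))"
    unfolding unit_integral_def poly_mult poly_monom poly_altdef[of p]
    by (simp add: sum_distrib_left power_add mult_ac)
  also have "\<dots> = (\<Sum>i\<le>degree p. LINT z:{0..1}|M. coeff p i * z ^ (k + i))"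
    using int unfolding set_lebesgue_integral_def set_integrable_def scaleR_sum_right
    by (subst Bochner_Integration.integral_sum) auto
  finally show ?thesis
    by (simp add: unit_moment_def)
qed

lemma exists_pade_denominator:
  assumes "m \<le> l + 1"
  obtains b where "b 0 = 1"
    "\<And>k. l < k \<Longrightarrow> k \<le> l + m \<Longrightarrow> (\<Sum>j\<le>min k m. b j * unit_moment (k - j)) = 0"
proof -
  interpret semidefinite_functional unit_integral "monom 1 (l + 1 - m)"
    by (rule semidefinite_unit_integral)
  obtain q where q: "degree q = m" "lead_coeff q = 1"
      "\<And>i. i < m \<Longrightarrow> unit_integral (monom 1 (l + 1 - m) * q * monom 1 i) = 0"
    using exists_monic_orthogonal[of m] by blast
  show thesis
  proof (rule that)
    show "coeff q (m - 0) = 1" using q by simp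
    fix k assume k: "l < k" "k \<le> l + m"
    \<comment> \<open>Hence \<open>min k m\<close> is \<open>m\<close>, and \<open>k - m\<close> is
      a true difference.\<close>
    then have "m \<le> k" using assms by simp
    have "(\<Sum>j\<le>min k m. coeff q (m - j) * unit_moment (k - j))
        = (\<Sum>i\<le>m. coeff q i * unit_moment (k - m + i))"
      using \<open>m \<le> k\<close> by (intro sum.reindex_bij_witness[of _ "\<lambda>i. m - i" "\<lambda>j. m - j"]) auto
    also have "\<dots> = unit_integral (monom 1 (k - m) * q)"
      by (simp add: unit_integral_monom_mult q)
    \<comment> \<open>As \<open>k\<close> runs from \<open>l + 1\<close> to \<open>l + m\<close>,
      the test exponent \<open>k - l - 1\<close> runs through 0, ..., \<open>m - 1\<close>, where
      \<open>q\<close> is orthogonal.\<close>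
    also have "monom 1 (k - m) * q = monom 1 (l + 1 - m) * q * monom 1 (k - l - 1)"
    proof -
      have "k - m = (l + 1 - m) + (k - l - 1)" using k assms by simp
      then have "monom (1::real) (k - m) = monom 1 (l + 1 - m) * monom 1 (k - l - 1)"
        by (simp add: mult_monom)
      then show ?thesis by (simp add: mult_ac)
    qed
    also have "unit_integral \<dots> = 0"
      using k by (intro q) auto
    finally show "(\<Sum>j\<le>min k m. coeff q (m - j) * unit_moment (k - j)) = 0" .
  qed
qed

end

theorem theorem2p1:
  fixes \<mu> :: "real \<Rightarrow> real" and f :: "complex \<Rightarrow> complex" and L M :: int
  assumes "mono_on {0..1} \<mu>"
    and "\<And>\<xi>. \<xi> \<notin> complex_of_real ` {..-1} \<Longrightarrow>
           f \<xi> = (LINT z:{0..1}|unit_stieltjes_measure \<mu>. 1 / (1 + complex_of_real z * \<xi>))"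
    and "L - M + 1 \<ge> 0" and "L \<noteq> -1" and "M \<ge> 0"
  shows "\<exists>a b. b 0 = 1 \<and> is_pade_approximant f (nat L) (nat M) a b"
proof -
  interpret finite_borel_measure "unit_stieltjes_measure \<mu>"
    by (rule finite_borel_measure_unit_stieltjes[OF assms(1)])
  let ?N = "nat L + nat M + 1"
  let ?s = "\<lambda>\<xi>. \<Sum>n<?N. complex_of_real (unit_moment n) * (- \<xi>) ^ n"
  \<comment> \<open>The hypotheses give L at least M - 1, hence at least -1; excluding -1 makes L
    nonnegative, so \<open>nat\<close> loses nothing.\<close>
  have "nat M \<le> nat L + 1" using assms(3-5) by linarith
  then obtain b where b: "b 0 = 1"
      "\<And>k. nat L < k \<Longrightarrow> k \<le> nat L + nat M \<Longrightarrow> (\<Sum>j\<le>min k (nat M). b j * unit_moment (k - j)) = 0"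
    by (rule exists_pade_denominator) blast
  \<comment> \<open>\<open>f\<close> is prescribed only off the cut, which the open unit disc
    avoids.\<close>
  have "\<forall>\<^sub>F \<xi> in at 0. norm (\<xi>::complex) < 1"
    by (intro order_tendstoD(2)[where y = 0] tendsto_norm_zero tendsto_ident_at) simp
  then have "\<forall>\<^sub>F \<xi> in at 0. f \<xi> - ?s \<xi>
      = (LINT z:{0..1}|unit_stieltjes_measure \<mu>. 1 / (1 + complex_of_real z * \<xi>)) - ?s \<xi>"
    by eventually_elim (subst assms(2), auto)
  then have "(\<lambda>\<xi>. f \<xi> - ?s \<xi>) \<in> O[at 0](\<lambda>\<xi>. \<xi> ^ ?N)"
    using stieltjes_transform_bigo[of ?N] by (simp only: landau_o.big.in_cong)
  from is_pade_approximant_if_linear_system[OF this b] b(1) show ?thesis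
    by blast
qed

end
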